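(* Let $(X,s)$ be a real metrizable topological vector space and let $d$ be a fixed metric on $X$ compatible with $s$. Let $f:X\to\overline{\mathbb R}$ and $x_0\in X$ satisfy $f(x_0)\in\mathbb R$. For $x_0^*\in X^*$, the following are equivalent: (i) $x_0^*\in\eth_d f(x_0)$. (ii) There exist sequences $\varepsilon_n>0$ and $\delta_n>0$ such that $\varepsilon_n\to0$, $\varepsilon_n/\delta_n\to0$, and $$f(x_0)+\langle x-x_0,x_0^*\rangle\le f(x)+\varepsilon_n$$ for every $n$ and every $x\in\overline B_d(x_0;\delta_n)$. (iii) $\displaystyle\limsup_{\varepsilon\downarrow0}\frac{\delta_{f-x_0^*}(\varepsilon;x_0)}{\varepsilon}=+\infty$.
   Context: $\overline{\mathbb R}=[-\infty,+\infty]$; $X^*$ is the topological dual and $\langle x,x^*\rangle:=x^*(x)$. A metric is compatible with $s$ if it generates $s$. $\overline B_d(x;r):=\{y\in X\mid d(x,y)\le r\}$. The function $f-x_0^*$ is $u\mapsto f(u)-\langle u,x_0^*\rangle$. Core subdifferential: for $f:X\to\overline{\mathbb R}$ and $x_0\in X$, $x_0^*\in X^*$ belongs to $\eth_d f(x_0)$ if $f(x_0)\in\mathbb R$ and there is a family $(\delta_\varepsilon)_{\varepsilon>0}\subset(0,+\infty)$ with $\limsup_{\varepsilon\downarrow0}\delta_\varepsilon/\varepsilon=+\infty$ such that $f(x_0)+\langle x-x_0,x_0^*\rangle\le f(x)+\varepsilon$ for every $\varepsilon>0$ and every $x\in\overline B_d(x_0;\delta_\varepsilon)$. If $f(x_0)\notin\mathbb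 R$, then $\eth_d f(x_0)=\emptyset$. $\varepsilon$-minimality radius: for $h:X\to\overline{\mathbb R}$ finite at $x_0$ and $\varepsilon\ge0$, $$\delta_h(\varepsilon;x_0):=\sup\{\delta\ge0\mid h(x_0)\le h(x)+\varepsilon\text{ for every }x\in\overline B_d(x_0;\delta)\}\in[0,+\infty].$$ *)

theory Defs
  imports "HOL-Analysis.Analysis"
begin

text \<open>The Hausdorff property is not part of the class; it follows from metrizability.\<close>

class real_topological_vector_space = real_vector + topological_ab_group_add +
  assumes tendsto_scaleR_Pair:
    "LIM p (nhds (c::real) \<times>\<^sub>F nhds a). fst p *\<^sub>R snd p :> nhds (c *\<^sub>R a)"

definition topological_dual :: "('a::real_topological_vector_space \<Rightarrow> real) set" where
  "topological_dual = {x'. linear x' \<and> continuous_on UNIV x'}"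

definition core_subdifferential ::
  "('a \<Rightarrow> 'a \<Rightarrow> real) \<Rightarrow> ('a::real_topological_vector_space \<Rightarrow> ereal) \<Rightarrow> 'a \<Rightarrow> ('a \<Rightarrow> real) set" where
  "core_subdifferential d f x0 =
     {x0' \<in> topological_dual. \<bar>f x0\<bar> \<noteq> \<infinity> \<and>
        (\<exists>\<delta> :: real \<Rightarrow> real.
           (\<forall>\<epsilon>>0. \<delta> \<epsilon> > 0) \<and>
           Limsup (at_right 0) (\<lambda>\<epsilon>. ereal (\<delta> \<epsilon> / \<epsilon>)) = \<infinity> \<and>
           (\<forall>\<epsilon>>0. \<forall>x \<in> Metric_space.mcball UNIV d x0 (\<delta> \<epsilon>).
              f x0 + ereal (x0' (x - x0)) \<le> f x + ereal \<epsilon>))}"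

text \<open>The intended range of the following is \<open>[0, \<infinity>]\<close>: for \<open>\<epsilon> \<ge> 0\<close> and \<open>d\<close> a metric,
  the radius \<open>0\<close> always belongs to the set.\<close>

definition minimality_radius ::
  "('a \<Rightarrow> 'a \<Rightarrow> real) \<Rightarrow> ('a \<Rightarrow> ereal) \<Rightarrow> real \<Rightarrow> 'a \<Rightarrow> ereal" where
  "minimality_radius d h \<epsilon> x0 =
     Sup (ereal ` {\<delta>. \<delta> \<ge> 0 \<and>
            (\<forall>x \<in> Metric_space.mcball UNIV d x0 \<delta>. h x0 \<le> h x + ereal \<epsilon>)})"

end

theory Submission
  imports Defs
begin

text \<open>
  Everything is governed by the relation \<open>P \<epsilon> \<delta>\<close> saying that the subgradient inequality with
  error \<open>\<epsilon>\<close> holds on the closed ball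
  of radius \<open>\<delta>\<close>. Because \<open>f x0\<close> is finite and \<open>x0'\<close> is linear, \<open>P \<epsilon> \<delta>\<close> is also the condition that
  defines the \<open>\<epsilon>\<close>-minimality radius of \<open>f - x0'\<close>. The three conditions are then different ways of
  saying one thing: for every slope \<open>M\<close> there are arbitrarily small \<open>\<epsilon> > 0\<close> that admit a radius
  \<open>\<delta> > M * \<epsilon>\<close> (\<open>superlinear_radii\<close>). For the sequences this is a diagonal choice, and for the
  minimality radius it is the definition of a supremum.

  The one condition that asks for more is the family in the core subdifferential, which needs a
  positive radius for \<^emph>\<open>every\<close> \<open>\<epsilon> > 0\<close> and not only along a sequence. Since \<open>P\<close> is monotone in
  \<open>\<epsilon>\<close>, a radius that works for a small error works for all larger ones, so positive radii always
  exist. The family is obtained by taking at each \<open>\<epsilon>\<close> a radius that is at least half the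
  supremum of the admissible ones, after truncation at \<open>1\<close>. The truncation takes care of an
  infinite supremum, and does not harm the quotient, as \<open>1 / \<epsilon>\<close> is itself unbounded.
\<close>

definition superlinear_radii :: "(real \<Rightarrow> real \<Rightarrow> bool) \<Rightarrow> bool" where
  "superlinear_radii P \<longleftrightarrow> (\<forall>M. \<exists>\<^sub>F \<epsilon> in at_right 0. \<exists>\<delta>>M * \<epsilon>. P \<epsilon> \<delta>)"

lemma Limsup_eq_PInfty_iff:
  fixes g :: "'b \<Rightarrow> ereal"
  shows "Limsup F g = \<infinity> \<longleftrightarrow> (\<forall>M::real. \<exists>\<^sub>F x in F. ereal M < g x)"
proof -
  have "Limsup F g = \<infinity> \<longleftrightarrow> \<not> (\<exists>M::real. \<forall>\<^sub>F x in F. g x \<le> ereal M)"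
  proof (intro iffI notI)
    assume inf: "Limsup F g = \<infinity>" and "\<exists>M::real. \<forall>\<^sub>F x in F. g x \<le> ereal M"
    then obtain M :: real where "\<forall>\<^sub>F x in F. g x \<le> ereal M" by blast
    then have "Limsup F g \<le> ereal M" by (rule Limsup_bounded)
    then show False using inf by simp
  next
    assume *: "\<not> (\<exists>M::real. \<forall>\<^sub>F x in F. g x \<le> ereal M)"
    show "Limsup F g = \<infinity>"
    proof (rule ccontr)
      assume "Limsup F g \<noteq> \<infinity>"
      then obtain M :: real where "Limsup F g < ereal M"
        using less_PInf_Ex_of_nat[of "Limsup F g"] by auto
      then have "\<forall>\<^sub>F x in F. g x < ereal M" by (rule Limsup_lessD)
      then have "\<forall>\<^sub>F x in F. g x \<le> ereal M" by eventually_elim simp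
      then show False using * by blast
    qed
  qed
  then show ?thesis
    by (simp add: frequently_def not_less)
qed

lemma frequently_at_right_0_iff:
  fixes Q :: "real \<Rightarrow> bool"
  shows "(\<exists>\<^sub>F \<epsilon> in at_right 0. Q \<epsilon>) \<longleftrightarrow> (\<forall>e>0. \<exists>\<epsilon>>0. \<epsilon> < e \<and> Q \<epsilon>)"
  unfolding frequently_def eventually_at_right_field by blast

lemma superlinear_radii_iff:
  "superlinear_radii P \<longleftrightarrow> (\<forall>M. \<forall>e>0. \<exists>\<epsilon>>0. \<epsilon> < e \<and> (\<exists>\<delta>>M * \<epsilon>. P \<epsilon> \<delta>))"
  unfolding superlinear_radii_def frequently_at_right_0_iff by blast

lemma superlinear_radii_iff_sequences:
  "superlinear_radii P \<longleftrightarrow>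
     (\<exists>\<epsilon> \<delta> :: nat \<Rightarrow> real. (\<forall>n. \<epsilon> n > 0) \<and> (\<forall>n. \<delta> n > 0) \<and>
        \<epsilon> \<longlonglongrightarrow> 0 \<and> (\<lambda>n. \<epsilon> n / \<delta> n) \<longlonglongrightarrow> 0 \<and> (\<forall>n. P (\<epsilon> n) (\<delta> n)))"
proof
  assume "superlinear_radii P"
  then have "\<forall>n::nat. \<exists>\<epsilon> \<delta>. \<epsilon> > 0 \<and> \<epsilon> < inverse (real (Suc n)) \<and> real (Suc n) * \<epsilon> < \<delta> \<and> P \<epsilon> \<delta>"
    unfolding superlinear_radii_iff by (metis inverse_positive_iff_positive of_nat_0_less_iff zero_less_Suc)
  then obtain \<epsilon> \<delta> :: "nat \<Rightarrow> real" where
    pos: "\<And>n. \<epsilon> n > 0" and small: "\<And>n. \<epsilon> n < inverse (real (Suc n))"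
    and large: "\<And>n. real (Suc n) * \<epsilon> n < \<delta> n" and P: "\<And>n. P (\<epsilon> n) (\<delta> n)"
    by metis
  have \<delta>_pos: "\<delta> n > 0" for n
    using large[of n] pos[of n] by (meson less_trans mult_pos_pos of_nat_0_less_iff zero_less_Suc)
  have "\<epsilon> \<longlonglongrightarrow> 0"
    by (rule tendsto_sandwich[OF _ _ tendsto_const LIMSEQ_inverse_real_of_nat])
       (use pos small in \<open>auto intro!: always_eventually less_imp_le\<close>)
  moreover have "\<epsilon> n / \<delta> n \<le> inverse (real (Suc n))" for n
    using large[of n] \<delta>_pos[of n] by (simp add: field_simps del: of_nat_Suc)
  then have "(\<lambda>n. \<epsilon> n / \<delta> n) \<longlonglongrightarrow> 0"
    by (intro tendsto_sandwich[OF _ _ tendsto_const LIMSEQ_inverse_real_of_nat])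
       (use pos \<delta>_pos in \<open>auto intro!: always_eventually divide_nonneg_nonneg less_imp_le\<close>)
  ultimately show "\<exists>\<epsilon> \<delta> :: nat \<Rightarrow> real. (\<forall>n. \<epsilon> n > 0) \<and> (\<forall>n. \<delta> n > 0) \<and>
        \<epsilon> \<longlonglongrightarrow> 0 \<and> (\<lambda>n. \<epsilon> n / \<delta> n) \<longlonglongrightarrow> 0 \<and> (\<forall>n. P (\<epsilon> n) (\<delta> n))"
    using pos \<delta>_pos P by blast
next
  assume "\<exists>\<epsilon> \<delta> :: nat \<Rightarrow> real. (\<forall>n. \<epsilon> n > 0) \<and> (\<forall>n. \<delta> n > 0) \<and>
        \<epsilon> \<longlonglongrightarrow> 0 \<and> (\<lambda>n. \<epsilon> n / \<delta> n) \<longlonglongrightarrow> 0 \<and> (\<forall>n. P (\<epsilon> n) (\<delta> n))"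
  then obtain \<epsilon> \<delta> :: "nat \<Rightarrow> real" where
    pos: "\<And>n. \<epsilon> n > 0" "\<And>n. \<delta> n > 0" and lim: "\<epsilon> \<longlonglongrightarrow> 0" "(\<lambda>n. \<epsilon> n / \<delta> n) \<longlonglongrightarrow> 0"
    and P: "\<And>n. P (\<epsilon> n) (\<delta> n)"
    by blast
  show "superlinear_radii P"
    unfolding superlinear_radii_iff
  proof (intro allI impI)
    fix M e :: real
    assume "e > 0"
    have "eventually (\<lambda>n. \<epsilon> n < e \<and> \<epsilon> n / \<delta> n < 1 / (\<bar>M\<bar> + 1)) sequentially"
      using order_tendstoD(2)[OF lim(1) \<open>e > 0\<close>] order_tendstoD(2)[OF lim(2), of "1 / (\<bar>M\<bar> + 1)"]
      by (auto intro: eventually_conj)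
    then obtain n where n: "\<epsilon> n < e" "\<epsilon> n / \<delta> n < 1 / (\<bar>M\<bar> + 1)"
      using eventually_happens'[OF sequentially_bot] by blast
    have "M * \<epsilon> n \<le> (\<bar>M\<bar> + 1) * \<epsilon> n"
      using pos(1)[of n] by (intro mult_right_mono) auto
    also have "\<dots> < \<delta> n"
      using n(2) pos(2)[of n] by (simp add: field_simps)
    finally show "\<exists>\<epsilon>>0. \<epsilon> < e \<and> (\<exists>\<delta>>M * \<epsilon>. P \<epsilon> \<delta>)"
      using n(1) pos(1) P by blast
  qed
qed

lemma superlinear_radii_iff_Limsup_Sup:
  "superlinear_radii P \<longleftrightarrow>
     Limsup (at_right 0) (\<lambda>\<epsilon>. Sup (ereal ` {\<delta>. \<delta> \<ge> 0 \<and> P \<epsilon> \<delta>}) / ereal \<epsilon>) = \<infinity>"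
proof -
  have less_iff: "ereal M < Sup (ereal ` {\<delta>. \<delta> \<ge> 0 \<and> P \<epsilon> \<delta>}) / ereal \<epsilon> \<longleftrightarrow>
        (\<exists>\<delta>>M * \<epsilon>. \<delta> \<ge> 0 \<and> P \<epsilon> \<delta>)" if "\<epsilon> > 0" for M \<epsilon> :: real
    using that by (auto simp: ereal_less_divide_pos less_Sup_iff mult.commute)
  show ?thesis
    unfolding Limsup_eq_PInfty_iff frequently_at_right_0_iff superlinear_radii_iff
  proof (intro iffI allI impI)
    fix M e :: real
    assume *: "\<forall>M. \<forall>e>0. \<exists>\<epsilon>>0. \<epsilon> < e \<and> (\<exists>\<delta>>M * \<epsilon>. P \<epsilon> \<delta>)" and "e > 0"
    \<comment> \<open>A nonnegative slope forces the radius to be nonnegative.\<close>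
    obtain \<epsilon> \<delta> where \<epsilon>: "\<epsilon> > 0" "\<epsilon> < e" "\<delta> > max M 0 * \<epsilon>" "P \<epsilon> \<delta>"
      using *[rule_format, OF \<open>e > 0\<close>, of "max M 0"] by blast
    have "M * \<epsilon> \<le> max M 0 * \<epsilon>" "0 \<le> max M 0 * \<epsilon>"
      using \<epsilon>(1) by (auto intro: mult_right_mono)
    then have "M * \<epsilon> < \<delta>" "\<delta> \<ge> 0"
      using \<epsilon>(3) by linarith+
    then have "\<exists>\<delta>>M * \<epsilon>. \<delta> \<ge> 0 \<and> P \<epsilon> \<delta>"
      using \<epsilon>(4) by blast
    then show "\<exists>\<epsilon>>0. \<epsilon> < e \<and> ereal M < Sup (ereal ` {\<delta>. \<delta> \<ge> 0 \<and> P \<epsilon> \<delta>}) / ereal \<epsilon>"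
      using less_iff[of _ M] \<epsilon>(1,2) by blast
  next
    fix M e :: real
    assume *: "\<forall>M. \<forall>e>0. \<exists>\<epsilon>>0. \<epsilon> < e \<and> ereal M < Sup (ereal ` {\<delta>. \<delta> \<ge> 0 \<and> P \<epsilon> \<delta>}) / ereal \<epsilon>"
      and "e > 0"
    then show "\<exists>\<epsilon>>0. \<epsilon> < e \<and> (\<exists>\<delta>>M * \<epsilon>. P \<epsilon> \<delta>)"
      using *[rule_format, OF \<open>e > 0\<close>, of M] less_iff[of _ M] by blast
  qed
qed

text \<open>
  A set of radii may be unbounded, and even a finite supremum need not be attained. The supremum
  of the radii truncated at \<open>1\<close> is finite and positive, so some member exceeds half of it.
\<close>

lemma exists_nearly_largest:
  fixes S :: "real set"
  assumes "\<delta>\<^sub>0 \<in> S" "\<delta>\<^sub>0 > 0"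
  shows "\<exists>\<delta>\<in>S. \<delta> > 0 \<and> (\<forall>\<delta>'\<in>S. min \<delta>' 1 / 2 \<le> \<delta>)"
proof -
  define s where "s = Sup ((\<lambda>\<delta>. min \<delta> 1) ` S)"
  have bdd: "bdd_above ((\<lambda>\<delta>. min \<delta> 1) ` S)"
    by (intro bdd_aboveI2[where M = 1]) auto
  have upper: "min \<delta> 1 \<le> s" if "\<delta> \<in> S" for \<delta>
    unfolding s_def using that bdd by (intro cSUP_upper)
  have "s > 0"
    using upper[OF assms(1)] assms(2) by linarith
  then have "s / 2 < Sup ((\<lambda>\<delta>. min \<delta> 1) ` S)"
    unfolding s_def by simp
  then obtain \<delta> where \<delta>: "\<delta> \<in> S" "s / 2 < min \<delta> 1"
    using less_cSUP_iff[OF _ bdd] assms(1) by blast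
  have "min \<delta>' 1 / 2 \<le> \<delta>" if "\<delta>' \<in> S" for \<delta>'
    using upper[OF that] \<delta>(2) by linarith
  then show ?thesis
    using \<delta> \<open>s > 0\<close> by (intro bexI[of _ \<delta>]) auto
qed

text \<open>
  Monotonicity in the error is what turns radii at some small errors into radii at all errors.
\<close>

lemma superlinear_radii_iff_family:
  assumes mono: "\<And>\<epsilon> \<epsilon>' \<delta>. \<epsilon> \<le> \<epsilon>' \<Longrightarrow> P \<epsilon> \<delta> \<Longrightarrow> P \<epsilon>' \<delta>"
  shows "superlinear_radii P \<longleftrightarrow>
     (\<exists>\<delta> :: real \<Rightarrow> real. (\<forall>\<epsilon>>0. \<delta> \<epsilon> > 0) \<and>
        Limsup (at_right 0) (\<lambda>\<epsilon>. ereal (\<delta> \<epsilon> / \<epsilon>)) = \<infinity> \<and> (\<forall>\<epsilon>>0. P \<epsilon> (\<delta> \<epsilon>)))"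
proof
  assume sup: "superlinear_radii P"
  have "\<exists>\<delta>. P \<epsilon> \<delta> \<and> \<delta> > 0 \<and> (\<forall>\<delta>'. P \<epsilon> \<delta>' \<longrightarrow> min \<delta>' 1 / 2 \<le> \<delta>)" if "\<epsilon> > 0" for \<epsilon>
  proof -
    obtain \<epsilon>' \<delta>\<^sub>0 where "\<epsilon>' < \<epsilon>" "\<delta>\<^sub>0 > 0 * \<epsilon>'" "P \<epsilon>' \<delta>\<^sub>0"
      using sup[unfolded superlinear_radii_iff, rule_format, OF \<open>\<epsilon> > 0\<close>, of 0] by blast
    then have "P \<epsilon> \<delta>\<^sub>0" "\<delta>\<^sub>0 > 0"
      using mono[of \<epsilon>' \<epsilon>] by auto
    then show ?thesis
      using exists_nearly_largest[of \<delta>\<^sub>0 "Collect (P \<epsilon>)"] by auto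
  qed
  then obtain \<delta> where \<delta>: "\<And>\<epsilon>. \<epsilon> > 0 \<Longrightarrow> P \<epsilon> (\<delta> \<epsilon>)" "\<And>\<epsilon>. \<epsilon> > 0 \<Longrightarrow> \<delta> \<epsilon> > 0"
    "\<And>\<epsilon> \<delta>'. \<epsilon> > 0 \<Longrightarrow> P \<epsilon> \<delta>' \<Longrightarrow> min \<delta>' 1 / 2 \<le> \<delta> \<epsilon>"
    by metis
  have "Limsup (at_right 0) (\<lambda>\<epsilon>. ereal (\<delta> \<epsilon> / \<epsilon>)) = \<infinity>"
    unfolding Limsup_eq_PInfty_iff frequently_at_right_0_iff
  proof (intro allI impI)
    fix M e :: real
    assume "e > 0"
    \<comment> \<open>The slope \<open>2 * M\<close> makes up for the lost factor \<open>1 / 2\<close>; the bound on \<open>\<epsilon>\<close> ensures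
      \<open>M * \<epsilon> < 1 / 2\<close>, so that the truncated radius is still large enough.\<close>
    then have pos: "min e (1 / (2 * (\<bar>M\<bar> + 1))) > 0"
      by simp
    obtain \<epsilon> \<delta>' where \<epsilon>: "\<epsilon> > 0" "\<epsilon> < min e (1 / (2 * (\<bar>M\<bar> + 1)))" "\<delta>' > (2 * M) * \<epsilon>" "P \<epsilon> \<delta>'"
      using sup[unfolded superlinear_radii_iff, rule_format, OF pos, of "2 * M"] by blast
    have "M * \<epsilon> \<le> (\<bar>M\<bar> + 1) * \<epsilon>"
      using \<epsilon>(1) by (intro mult_right_mono) auto
    also have "\<dots> < 1 / 2"
      using \<epsilon>(2) by (simp add: field_simps)
    finally have "M * \<epsilon> < min \<delta>' 1 / 2"
      using \<epsilon>(3) by (simp add: min_def)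
    also have "\<dots> \<le> \<delta> \<epsilon>"
      using \<delta>(3) \<epsilon> by blast
    finally have "ereal M < ereal (\<delta> \<epsilon> / \<epsilon>)"
      using \<epsilon>(1) by (simp add: field_simps)
    then show "\<exists>\<epsilon>>0. \<epsilon> < e \<and> ereal M < ereal (\<delta> \<epsilon> / \<epsilon>)"
      using \<epsilon>(1,2) by auto
  qed
  then show "\<exists>\<delta> :: real \<Rightarrow> real. (\<forall>\<epsilon>>0. \<delta> \<epsilon> > 0) \<and>
        Limsup (at_right 0) (\<lambda>\<epsilon>. ereal (\<delta> \<epsilon> / \<epsilon>)) = \<infinity> \<and> (\<forall>\<epsilon>>0. P \<epsilon> (\<delta> \<epsilon>))"
    using \<delta>(1,2) by blast
next
  assume "\<exists>\<delta> :: real \<Rightarrow> real. (\<forall>\<epsilon>>0. \<delta> \<epsilon> > 0) \<and>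
        Limsup (at_right 0) (\<lambda>\<epsilon>. ereal (\<delta> \<epsilon> / \<epsilon>)) = \<infinity> \<and> (\<forall>\<epsilon>>0. P \<epsilon> (\<delta> \<epsilon>))"
  then obtain \<delta> :: "real \<Rightarrow> real" where
    lim: "\<forall>M. \<forall>e>0. \<exists>\<epsilon>>0. \<epsilon> < e \<and> M < \<delta> \<epsilon> / \<epsilon>" and P: "\<And>\<epsilon>. \<epsilon> > 0 \<Longrightarrow> P \<epsilon> (\<delta> \<epsilon>)"
    unfolding Limsup_eq_PInfty_iff frequently_at_right_0_iff by auto
  show "superlinear_radii P"
    unfolding superlinear_radii_iff
  proof (intro allI impI)
    fix M e :: real
    assume "e > 0"
    then obtain \<epsilon> where \<epsilon>: "\<epsilon> > 0" "\<epsilon> < e" "M < \<delta> \<epsilon> / \<epsilon>"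
      using lim by blast
    then have "M * \<epsilon> < \<delta> \<epsilon>"
      by (simp add: field_simps)
    then show "\<exists>\<epsilon>>0. \<epsilon> < e \<and> (\<exists>\<delta>>M * \<epsilon>. P \<epsilon> \<delta>)"
      using \<epsilon> P by blast
  qed
qed

text \<open>
  Tilting by \<open>x'\<close> adds the finite number \<open>x' x\<close> to both sides, which is harmless even where \<open>f\<close>
  takes infinite values.
\<close>

lemma tilted_minimality_iff_subgradient_inequality:
  fixes f :: "'a::real_vector \<Rightarrow> ereal" and x' :: "'a \<Rightarrow> real"
  assumes "linear x'" "\<bar>f x0\<bar> \<noteq> \<infinity>"
  shows "f x0 - ereal (x' x0) \<le> (f x - ereal (x' x)) + ereal \<epsilon> \<longleftrightarrow>
         f x0 + ereal (x' (x - x0)) \<le> f x + ereal \<epsilon>"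
  using assms(2) by (cases "f x0"; cases "f x") (auto simp: linear_diff[OF assms(1)])

theorem theorem10:
  fixes d :: "'a::real_topological_vector_space \<Rightarrow> 'a \<Rightarrow> real"
    and f :: "'a \<Rightarrow> ereal"
    and x0 :: 'a
    and x0' :: "'a \<Rightarrow> real"
  assumes metric: "Metric_space UNIV d"
    and compatible: "Metric_space.mtopology UNIV d = euclidean"
    and finite: "\<bar>f x0\<bar> \<noteq> \<infinity>"
    and dual: "x0' \<in> topological_dual"
  shows "(x0' \<in> core_subdifferential d f x0
            \<longleftrightarrow> (\<exists>\<epsilon> \<delta> :: nat \<Rightarrow> real.
                  (\<forall>n. \<epsilon> n > 0) \<and> (\<forall>n. \<delta> n > 0) \<and>
                  \<epsilon> \<longlonglongrightarrow> 0 \<and> (\<lambda>n. \<epsilon> n / \<delta> n) \<longlonglongrightarrow> 0 \<and>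
                  (\<forall>n. \<forall>x \<in> Metric_space.mcball UNIV d x0 (\<delta> n).
                     f x0 + ereal (x0' (x - x0)) \<le> f x + ereal (\<epsilon> n))))
       \<and> (x0' \<in> core_subdifferential d f x0
            \<longleftrightarrow> Limsup (at_right 0)
                  (\<lambda>\<epsilon>. minimality_radius d (\<lambda>u. f u - ereal (x0' u)) \<epsilon> x0 / ereal \<epsilon>) = \<infinity>)"
proof -
  define P where "P \<epsilon> \<delta> \<longleftrightarrow> (\<forall>x \<in> Metric_space.mcball UNIV d x0 \<delta>.
      f x0 + ereal (x0' (x - x0)) \<le> f x + ereal \<epsilon>)" for \<epsilon> \<delta>
  have mono: "P \<epsilon>' \<delta>" if "\<epsilon> \<le> \<epsilon>'" "P \<epsilon> \<delta>" for \<epsilon> \<epsilon>' \<delta>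
    using that unfolding P_def by (meson add_left_mono ereal_less_eq(3) order_trans)
  have "linear x0'"
    using dual by (simp add: topological_dual_def)
  then have radius: "minimality_radius d (\<lambda>u. f u - ereal (x0' u)) \<epsilon> x0
      = Sup (ereal ` {\<delta>. \<delta> \<ge> 0 \<and> P \<epsilon> \<delta>})" for \<epsilon>
    unfolding minimality_radius_def P_def
    by (simp add: tilted_minimality_iff_subgradient_inequality[where f = f, OF _ finite])
  have "x0' \<in> core_subdifferential d f x0 \<longleftrightarrow> superlinear_radii P"
    using superlinear_radii_iff_family[of P, OF mono] dual finite
    unfolding core_subdifferential_def P_def by simp
  moreover note superlinear_radii_iff_sequences[of P] superlinear_radii_iff_Limsup_Sup[of P]
  ultimately show ?thesis
    unfolding radius by (simp add: P_def)
qed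

end
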